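(* The Yamabe flow on modified Riemann extensions is stationary: if $\bar g(t)$ is a one-parameter family of metrics on $T^*M$, each of which is a modified Riemann extension, satisfying the Yamabe flow equation $\frac{\partial \bar g}{\partial t}=(\bar S-\bar R)\bar g$, then $\frac{\partial \bar g}{\partial t}=0$.
   Context: Let $M$ be an $n$-dimensional manifold with a torsion-free affine connection $\nabla$ with connection coefficients $\Gamma^l_{ij}$, and let $c=(c_{ij})$ be a symmetric $(0,2)$ tensor on $M$. The modified Riemann extension of $(M,\nabla)$ (determined by $c$) is the cotangent bundle $T^*M$ with the (pseudo-Riemannian) metric $\bar g$ whose components, in the coordinates $(x^1,\dots,x^n,\omega_1,\dots,\omega_n)$ induced from local coordinates $x^i$ on $M$ ($\omega_l$ being the fibre coordinates), are $$\bar g_{ij}=-2\omega_l\Gamma^l_{ij}+c_{ij},\qquad \bar g_{ij^*}=\bar g_{i^*j}=\delta_i^j,\qquad \bar g_{i^*j^*}=0,$$ where $i,j$ range over $1,\dots,n$ and $i^*=n+i$, $j^*=n+j$ range over $n+1,\dots,2n$. In a family $\bar g(t)$ of such metrics, $\nabla$ and $c$ may depend on $t$. $\bar R$ denotes the scalar curvature of $\bar g$ and $\bar S$ its average scalar curvature; when the scalar curvature is constant on $T^*M$, its average is that constant. *)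

theory Defs
  imports "HOL-Analysis.Analysis"
begin

section \<open>Smooth functions on open subsets of Euclidean space\<close>

definition partial :: "'m::finite \<Rightarrow> (real^'m \<Rightarrow> real) \<Rightarrow> real^'m \<Rightarrow> real" where
  "partial i f x = deriv (\<lambda>s. f (x + s *\<^sub>R axis i 1)) 0"

text \<open>Only used for open sets.\<close>
primrec Ck_on :: "nat \<Rightarrow> (real^'m::finite) set \<Rightarrow> (real^'m \<Rightarrow> real) \<Rightarrow> bool" where
  "Ck_on 0 S f \<longleftrightarrow> continuous_on S f"
| "Ck_on (Suc k) S f \<longleftrightarrow> f differentiable_on S \<and> (\<forall>i. Ck_on k S (partial i f))"

definition smooth_on :: "(real^'m::finite) set \<Rightarrow> (real^'m \<Rightarrow> real) \<Rightarrow> bool" where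
  "smooth_on S f \<longleftrightarrow> (\<forall>k. Ck_on k S f)"


section \<open>Smooth manifolds\<close>

text \<open>
  A chart is a domain together with its coordinate map; the values of the map outside the domain
  are irrelevant.  A manifold is given by an atlas, which determines both the underlying set and the
  topology.  The dimension is the cardinality of the type indexing the coordinates.
\<close>

type_synonym ('a, 'm) chart = "'a set \<times> ('a \<Rightarrow> real^'m)"

abbreviation chart_inv :: "('a, 'm::finite) chart \<Rightarrow> real^'m \<Rightarrow> 'a" where
  "chart_inv ch \<equiv> inv_into (fst ch) (snd ch)"

definition points :: "('a, 'm::finite) chart set \<Rightarrow> 'a set" where
  "points A = (\<Union>ch\<in>A. fst ch)"

definition manifold_open :: "('a, 'm::finite) chart set \<Rightarrow> 'a set \<Rightarrow> bool" where
  "manifold_open A W \<longleftrightarrow> W \<subseteq> points A \<and>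
     (\<forall>ch\<in>A. \<exists>Q. open Q \<and> W \<inter> fst ch = {p \<in> fst ch. snd ch p \<in> Q})"

lemma istopology_manifold_open: "istopology (manifold_open A)"
  unfolding istopology_def
proof (intro conjI allI impI)
  fix S T assume S: "manifold_open A S" and T: "manifold_open A T"
  show "manifold_open A (S \<inter> T)"
    unfolding manifold_open_def
  proof (intro conjI ballI)
    show "S \<inter> T \<subseteq> points A" using S by (auto simp: manifold_open_def)
    fix ch assume "ch \<in> A"
    then obtain P Q where "open P" "S \<inter> fst ch = {p \<in> fst ch. snd ch p \<in> P}"
      "open Q" "T \<inter> fst ch = {p \<in> fst ch. snd ch p \<in> Q}"
      using S T unfolding manifold_open_def by meson
    then show "\<exists>Q. open Q \<and> (S \<inter> T) \<inter> fst ch = {p \<in> fst ch. snd ch p \<in> Q}"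
      by (intro exI[of _ "P \<inter> Q"]) auto
  qed
next
  fix K assume K: "\<forall>W\<in>K. manifold_open A W"
  show "manifold_open A (\<Union>K)"
    unfolding manifold_open_def
  proof (intro conjI ballI)
    show "\<Union>K \<subseteq> points A" using K by (auto simp: manifold_open_def)
    fix ch assume "ch \<in> A"
    then have "\<forall>W\<in>K. \<exists>Q. open Q \<and> W \<inter> fst ch = {p \<in> fst ch. snd ch p \<in> Q}"
      using K by (auto simp: manifold_open_def)
    then obtain Q where Q: "\<forall>W\<in>K. open (Q W) \<and> W \<inter> fst ch = {p \<in> fst ch. snd ch p \<in> Q W}"
      by metis
    then show "\<exists>Q. open Q \<and> \<Union>K \<inter> fst ch = {p \<in> fst ch. snd ch p \<in> Q}"
      by (intro exI[of _ "\<Union>(Q ` K)"]) blast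
  qed
qed

definition mtop :: "('a, 'm::finite) chart set \<Rightarrow> 'a topology" where
  "mtop A = topology (manifold_open A)"

lemma openin_mtop: "openin (mtop A) W \<longleftrightarrow> manifold_open A W"
  by (simp add: mtop_def istopology_manifold_open)

definition smooth_manifold :: "('a, 'm::finite) chart set \<Rightarrow> bool" where
  "smooth_manifold A \<longleftrightarrow>
     (\<forall>ch\<in>A. inj_on (snd ch) (fst ch) \<and> open (snd ch ` fst ch)) \<and>
     (\<forall>ch\<in>A. \<forall>ch'\<in>A. open (snd ch ` (fst ch \<inter> fst ch')) \<and>
        (\<forall>k. smooth_on (snd ch ` (fst ch \<inter> fst ch')) (\<lambda>x. snd ch' (chart_inv ch x) $ k))) \<and>
     Hausdorff_space (mtop A) \<and> second_countable (mtop A)"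

text \<open>For \<open>W\<close> open in the manifold.\<close>
definition smooth_fun_on :: "('a, 'm::finite) chart set \<Rightarrow> 'a set \<Rightarrow> ('a \<Rightarrow> real) \<Rightarrow> bool" where
  "smooth_fun_on A W f \<longleftrightarrow> (\<forall>ch\<in>A. smooth_on (snd ch ` (W \<inter> fst ch)) (\<lambda>x. f (chart_inv ch x)))"

definition smooth_near :: "('a, 'm::finite) chart set \<Rightarrow> 'a \<Rightarrow> ('a \<Rightarrow> real) \<Rightarrow> bool" where
  "smooth_near A p f \<longleftrightarrow> (\<exists>W. openin (mtop A) W \<and> p \<in> W \<and> smooth_fun_on A W f)"


section \<open>Tangent vectors, vector fields and connections\<close>

text \<open>
  Tangent vectors at \<open>p\<close> are the derivations of the functions that are smooth near \<open>p\<close>, extended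
  by \<open>0\<close> to all other functions.  The Leibniz rule forces a derivation to depend only on germs.
  For \<open>p\<close> outside the manifold no function is smooth near \<open>p\<close>, so that the tangent space is zero
  there.
\<close>

type_synonym 'a tvec = "('a \<Rightarrow> real) \<Rightarrow> real"

definition tangent_space :: "('a, 'm::finite) chart set \<Rightarrow> 'a \<Rightarrow> 'a tvec set" where
  "tangent_space A p = {v.
     (\<forall>f h a b. smooth_near A p f \<longrightarrow> smooth_near A p h \<longrightarrow>
        v (\<lambda>q. a * f q + b * h q) = a * v f + b * v h) \<and>
     (\<forall>f h. smooth_near A p f \<longrightarrow> smooth_near A p h \<longrightarrow>
        v (\<lambda>q. f q * h q) = f p * v h + h p * v f) \<and>
     (\<forall>f. \<not> smooth_near A p f \<longrightarrow> v f = 0)}"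

definition coord_vec :: "('a, 'm::finite) chart set \<Rightarrow> ('a, 'm) chart \<Rightarrow> 'm \<Rightarrow> 'a \<Rightarrow> 'a tvec" where
  "coord_vec A ch i p f =
     (if smooth_near A p f then partial i (\<lambda>x. f (chart_inv ch x)) (snd ch p) else 0)"

definition vector_field :: "('a, 'm::finite) chart set \<Rightarrow> ('a \<Rightarrow> 'a tvec) \<Rightarrow> bool" where
  "vector_field A X \<longleftrightarrow> (\<forall>p. X p \<in> tangent_space A p) \<and>
     (\<forall>W f. openin (mtop A) W \<longrightarrow> smooth_fun_on A W f \<longrightarrow> smooth_fun_on A W (\<lambda>p. X p f))"

text \<open>\<open>D X Y\<close> is the covariant derivative of \<open>Y\<close> in direction \<open>X\<close>.\<close>

definition affine_connection ::
    "('a, 'm::finite) chart set \<Rightarrow> (('a \<Rightarrow> 'a tvec) \<Rightarrow> ('a \<Rightarrow> 'a tvec) \<Rightarrow> 'a \<Rightarrow> 'a tvec) \<Rightarrow> bool" where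
  "affine_connection A D \<longleftrightarrow>
     (\<forall>X Y. vector_field A X \<longrightarrow> vector_field A Y \<longrightarrow> vector_field A (D X Y)) \<and>
     (\<forall>X Z Y f h. vector_field A X \<longrightarrow> vector_field A Z \<longrightarrow> vector_field A Y \<longrightarrow>
        smooth_fun_on A (points A) f \<longrightarrow> smooth_fun_on A (points A) h \<longrightarrow>
        D (\<lambda>p u. f p * X p u + h p * Z p u) Y = (\<lambda>p u. f p * D X Y p u + h p * D Z Y p u)) \<and>
     (\<forall>X Y Z a b. vector_field A X \<longrightarrow> vector_field A Y \<longrightarrow> vector_field A Z \<longrightarrow>
        D X (\<lambda>p u. a * Y p u + b * Z p u) = (\<lambda>p u. a * D X Y p u + b * D X Z p u)) \<and>
     (\<forall>X Y f. vector_field A X \<longrightarrow> vector_field A Y \<longrightarrow> smooth_fun_on A (points A) f \<longrightarrow>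
        D X (\<lambda>p u. f p * Y p u) = (\<lambda>p u. X p f * Y p u + f p * D X Y p u))"

definition torsion_free ::
    "('a, 'm::finite) chart set \<Rightarrow> (('a \<Rightarrow> 'a tvec) \<Rightarrow> ('a \<Rightarrow> 'a tvec) \<Rightarrow> 'a \<Rightarrow> 'a tvec) \<Rightarrow> bool" where
  "torsion_free A D \<longleftrightarrow>
     (\<forall>X Y p f. vector_field A X \<longrightarrow> vector_field A Y \<longrightarrow> p \<in> points A \<longrightarrow> smooth_near A p f \<longrightarrow>
        D X Y p f - D Y X p f = X p (\<lambda>q. Y q f) - Y p (\<lambda>q. X q f))"

text \<open>
  The coefficients \<open>\<Gamma>\<^sup>l\<^sub>i\<^sub>j\<close> defined by \<open>\<nabla>\<^bsub>\<partial>\<^sub>i\<^esub> \<partial>\<^sub>j = \<Gamma>\<^sup>l\<^sub>i\<^sub>j \<partial>\<^sub>l\<close>.  The coordinate fields are only defined on the chart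
  domain, so \<open>\<nabla>\<close> is applied to any global vector fields which agree with them near \<open>p\<close>.
\<close>
definition connection_coeff ::
    "('a, 'm::finite) chart set \<Rightarrow> (('a \<Rightarrow> 'a tvec) \<Rightarrow> ('a \<Rightarrow> 'a tvec) \<Rightarrow> 'a \<Rightarrow> 'a tvec) \<Rightarrow>
     ('a, 'm) chart \<Rightarrow> 'a \<Rightarrow> 'm \<Rightarrow> 'm \<Rightarrow> 'm \<Rightarrow> real" where
  "connection_coeff A D ch p i j =
     (THE \<Gamma>. \<forall>X Y W. vector_field A X \<longrightarrow> vector_field A Y \<longrightarrow>
        openin (mtop A) W \<longrightarrow> p \<in> W \<longrightarrow> W \<subseteq> fst ch \<longrightarrow>
        (\<forall>q\<in>W. X q = coord_vec A ch i q \<and> Y q = coord_vec A ch j q) \<longrightarrow>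
        D X Y p = (\<lambda>u. \<Sum>l\<in>UNIV. \<Gamma> l * coord_vec A ch l p u))"


section \<open>Symmetric (0,2) tensors and pseudo-Riemannian metrics\<close>

text \<open>Only the values on tangent vectors at points of the manifold are relevant.\<close>

type_synonym 'a tensor02 = "'a \<Rightarrow> 'a tvec \<Rightarrow> 'a tvec \<Rightarrow> real"

definition tensor_comp ::
    "('a, 'm::finite) chart set \<Rightarrow> 'a tensor02 \<Rightarrow> ('a, 'm) chart \<Rightarrow> 'a \<Rightarrow> 'm \<Rightarrow> 'm \<Rightarrow> real" where
  "tensor_comp A g ch p i j = g p (coord_vec A ch i p) (coord_vec A ch j p)"

definition symmetric_tensor :: "('a, 'm::finite) chart set \<Rightarrow> 'a tensor02 \<Rightarrow> bool" where
  "symmetric_tensor A g \<longleftrightarrow>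
     (\<forall>p\<in>points A. \<forall>v\<in>tangent_space A p. \<forall>w\<in>tangent_space A p. g p v w = g p w v) \<and>
     (\<forall>p\<in>points A. \<forall>u\<in>tangent_space A p. \<forall>v\<in>tangent_space A p. \<forall>w\<in>tangent_space A p. \<forall>a b.
        g p (\<lambda>f. a * u f + b * v f) w = a * g p u w + b * g p v w) \<and>
     (\<forall>ch\<in>A. \<forall>i j. smooth_fun_on A (fst ch) (\<lambda>p. tensor_comp A g ch p i j))"

definition pseudo_riemannian_metric :: "('a, 'm::finite) chart set \<Rightarrow> 'a tensor02 \<Rightarrow> bool" where
  "pseudo_riemannian_metric A g \<longleftrightarrow> symmetric_tensor A g \<and>
     (\<forall>p\<in>points A. \<forall>v\<in>tangent_space A p.
        (\<forall>w\<in>tangent_space A p. g p v w = 0) \<longrightarrow> v = (\<lambda>f. 0))"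


section \<open>Scalar curvature\<close>

text \<open>\<open>G\<close> is a matrix-valued function of the coordinates.\<close>

text \<open>\<open>christoffel G l i j\<close> is \<open>\<Gamma>\<^sup>l\<^sub>i\<^sub>j\<close>.\<close>
definition christoffel ::
    "(real^'m::finite \<Rightarrow> real^'m^'m) \<Rightarrow> 'm \<Rightarrow> 'm \<Rightarrow> 'm \<Rightarrow> real^'m \<Rightarrow> real" where
  "christoffel G l i j x = 1/2 * (\<Sum>k\<in>UNIV. matrix_inv (G x) $ l $ k *
     (partial i (\<lambda>y. G y $ j $ k) x + partial j (\<lambda>y. G y $ i $ k) x - partial k (\<lambda>y. G y $ i $ j) x))"

text \<open>\<open>riemann G l k i j\<close> is the \<open>l\<close>-th component of \<open>R(\<partial>\<^sub>i, \<partial>\<^sub>j) \<partial>\<^sub>k\<close>, where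
  \<open>R(X, Y) = \<nabla>\<^sub>X \<nabla>\<^sub>Y - \<nabla>\<^sub>Y \<nabla>\<^sub>X - \<nabla>\<^bsub>[X, Y]\<^esub>\<close>.\<close>
definition riemann ::
    "(real^'m::finite \<Rightarrow> real^'m^'m) \<Rightarrow> 'm \<Rightarrow> 'm \<Rightarrow> 'm \<Rightarrow> 'm \<Rightarrow> real^'m \<Rightarrow> real" where
  "riemann G l k i j x =
     partial i (christoffel G l j k) x - partial j (christoffel G l i k) x +
     (\<Sum>r\<in>UNIV. christoffel G r j k x * christoffel G l i r x -
                 christoffel G r i k x * christoffel G l j r x)"

definition ricci :: "(real^'m::finite \<Rightarrow> real^'m^'m) \<Rightarrow> 'm \<Rightarrow> 'm \<Rightarrow> real^'m \<Rightarrow> real" where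
  "ricci G j k x = (\<Sum>l\<in>UNIV. riemann G l k l j x)"

definition scalar_curvature_coord :: "(real^'m::finite \<Rightarrow> real^'m^'m) \<Rightarrow> real^'m \<Rightarrow> real" where
  "scalar_curvature_coord G x = (\<Sum>j\<in>UNIV. \<Sum>k\<in>UNIV. matrix_inv (G x) $ j $ k * ricci G j k x)"

text \<open>For a metric the value does not depend on the chart chosen.\<close>
definition scalar_curvature :: "('a, 'm::finite) chart set \<Rightarrow> 'a tensor02 \<Rightarrow> 'a \<Rightarrow> real" where
  "scalar_curvature A g p =
     (let ch = (SOME ch. ch \<in> A \<and> p \<in> fst ch)
      in scalar_curvature_coord (\<lambda>x. \<chi> i j. tensor_comp A g ch (chart_inv ch x) i j) (snd ch p))"

text \<open>
  On a non-compact manifold such as a cotangent bundle the quotient of the integral of the scalar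
  curvature by the volume need not make sense.  The only property required of an average value
  \<open>s\<close> is that it is the value of the scalar curvature whenever the latter is constant, so that every
  reading of ``average'' with this normalisation is covered.
\<close>
definition is_average_scalar_curvature ::
    "('a, 'm::finite) chart set \<Rightarrow> 'a tensor02 \<Rightarrow> real \<Rightarrow> bool" where
  "is_average_scalar_curvature A g s \<longleftrightarrow>
     (\<forall>k. (\<forall>p\<in>points A. scalar_curvature A g p = k) \<longrightarrow> s = k)"


section \<open>The cotangent bundle\<close>

type_synonym 'a covec = "'a tvec \<Rightarrow> real"

text \<open>Linear forms on the tangent space, extended by \<open>0\<close>.\<close>
definition cotangent_space :: "('a, 'm::finite) chart set \<Rightarrow> 'a \<Rightarrow> 'a covec set" where
  "cotangent_space A p = {\<alpha>.
     (\<forall>v\<in>tangent_space A p. \<forall>w\<in>tangent_space A p. \<forall>a b.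
        \<alpha> (\<lambda>f. a * v f + b * w f) = a * \<alpha> v + b * \<alpha> w) \<and>
     (\<forall>v. v \<notin> tangent_space A p \<longrightarrow> \<alpha> v = 0)}"

text \<open>The fibre coordinate \<open>\<omega>\<^sub>i\<close>, so that \<open>\<alpha> = \<omega>\<^sub>i dx\<^sup>i\<close>.\<close>
definition fibre_coord ::
    "('a, 'n::finite) chart set \<Rightarrow> ('a, 'n) chart \<Rightarrow> 'n \<Rightarrow> 'a \<times> 'a covec \<Rightarrow> real" where
  "fibre_coord A ch i = (\<lambda>(p, \<alpha>). \<alpha> (coord_vec A ch i p))"

text \<open>The induced coordinates are indexed by \<open>Inl i\<close> (the index \<open>i\<close>) and \<open>Inr i\<close> (the index \<open>i\<^sup>* = n + i\<close>).\<close>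
definition cotangent_chart ::
    "('a, 'n::finite) chart set \<Rightarrow> ('a, 'n) chart \<Rightarrow> ('a \<times> 'a covec, 'n + 'n) chart" where
  "cotangent_chart A ch =
     ({(p, \<alpha>). p \<in> fst ch \<and> \<alpha> \<in> cotangent_space A p},
      \<lambda>(p, \<alpha>). \<chi> k. case k of Inl i \<Rightarrow> snd ch p $ i | Inr i \<Rightarrow> fibre_coord A ch i (p, \<alpha>))"

definition cotangent_bundle ::
    "('a, 'n::finite) chart set \<Rightarrow> ('a \<times> 'a covec, 'n + 'n) chart set" where
  "cotangent_bundle A = cotangent_chart A ` A"

definition modified_riemann_extension ::
    "('a, 'n::finite) chart set \<Rightarrow> (('a \<Rightarrow> 'a tvec) \<Rightarrow> ('a \<Rightarrow> 'a tvec) \<Rightarrow> 'a \<Rightarrow> 'a tvec) \<Rightarrow>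
     'a tensor02 \<Rightarrow> ('a \<times> 'a covec) tensor02 \<Rightarrow> bool" where
  "modified_riemann_extension A D c g \<longleftrightarrow>
     pseudo_riemannian_metric (cotangent_bundle A) g \<and>
     (\<forall>ch\<in>A. \<forall>q\<in>fst (cotangent_chart A ch). \<forall>i j.
        let gc = tensor_comp (cotangent_bundle A) g (cotangent_chart A ch) q in
          gc (Inl i) (Inl j) =
            - 2 * (\<Sum>l\<in>UNIV. fibre_coord A ch l q * connection_coeff A D ch (fst q) i j l)
            + tensor_comp A c ch (fst q) i j \<and>
          gc (Inl i) (Inr j) = (if i = j then 1 else 0) \<and>
          gc (Inr i) (Inl j) = (if i = j then 1 else 0) \<and>
          gc (Inr i) (Inr j) = 0)"


section \<open>The Yamabe flow\<close>

text \<open>\<open>\<partial>g/\<partial>t = h\<close> at time \<open>t\<close>, in the components with respect to every chart of the atlas.\<close>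
definition has_time_derivative ::
    "('a, 'm::finite) chart set \<Rightarrow> (real \<Rightarrow> 'a tensor02) \<Rightarrow> 'a tensor02 \<Rightarrow> real \<Rightarrow> real set \<Rightarrow> bool" where
  "has_time_derivative A g h t I \<longleftrightarrow>
     (\<forall>ch\<in>A. \<forall>p\<in>fst ch. \<forall>i j.
        ((\<lambda>s. tensor_comp A (g s) ch p i j) has_real_derivative tensor_comp A h ch p i j)
          (at t within I))"

definition yamabe_flow ::
    "('a, 'm::finite) chart set \<Rightarrow> real set \<Rightarrow> (real \<Rightarrow> 'a tensor02) \<Rightarrow> (real \<Rightarrow> real) \<Rightarrow> bool" where
  "yamabe_flow A I g S \<longleftrightarrow>
     (\<forall>t\<in>I. is_average_scalar_curvature A (g t) (S t) \<and>
        has_time_derivative A g (\<lambda>p v w. (S t - scalar_curvature A (g t) p) * g t p v w) t I)"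

end

(* In induced coordinates every modified Riemann extension has the component g_{i i*} = 1, so the
   flow equation, read in this component, says that S - R vanishes at every point; no curvature has
   to be computed. *)

theory Submission
  imports Defs
begin

theorem theorem3p8:
  fixes M :: "('a, 'n::finite) chart set"
    and I :: "real set"
    and D :: "real \<Rightarrow> ('a \<Rightarrow> 'a tvec) \<Rightarrow> ('a \<Rightarrow> 'a tvec) \<Rightarrow> 'a \<Rightarrow> 'a tvec"
    and c :: "real \<Rightarrow> 'a tensor02"
    and g :: "real \<Rightarrow> ('a \<times> 'a covec) tensor02"
    and S :: "real \<Rightarrow> real"
  assumes "smooth_manifold M"
    and "is_interval I" and "interior I \<noteq> {}"
    and "\<And>t. t \<in> I \<Longrightarrow> affine_connection M (D t) \<and> torsion_free M (D t)"
    and "\<And>t. t \<in> I \<Longrightarrow> symmetric_tensor M (c t)"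
    and "\<And>t. t \<in> I \<Longrightarrow> modified_riemann_extension M (D t) (c t) (g t)"
    and "yamabe_flow (cotangent_bundle M) I g S"
  shows "\<forall>t\<in>I. has_time_derivative (cotangent_bundle M) g (\<lambda>q v w. 0) t I"
proof -
  let ?A = "cotangent_bundle M"
  \<comment> \<open>A one-point set of reals has empty interior. This matters because derivatives
    within \<open>I\<close> are unique only at limit points of \<open>I\<close>.\<close>
  have "\<not> is_singleton I"
    using assms(3) by (auto simp: is_singleton_def)
  \<comment> \<open>A connected set with more than one point has no isolated points, so this covers
    the endpoints of \<open>I\<close> as well.\<close>
  then have nontrivial: "at t within I \<noteq> bot" if "t \<in> I" for t
    using that connected_imp_perfect[of I t] is_interval_connected[OF assms(2)]
    by (auto simp: trivial_limit_within is_singleton_def)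
  have curvature: "scalar_curvature ?A (g t) q = S t"
    if t: "t \<in> I" and ch: "ch \<in> M" and q: "q \<in> fst (cotangent_chart M ch)" for t ch q
  proof -
    \<comment> \<open>Types are nonempty, so an index exists. Pairing \<open>Inl i\<close> with its
      own dual \<open>Inr i\<close> selects a component that is nonzero and independent of
      time.\<close>
    fix i :: 'n
    let ?gc = "\<lambda>s. tensor_comp ?A (g s) (cotangent_chart M ch) q (Inl i) (Inr i)"
    have one: "?gc s = 1" if "s \<in> I" for s
      using assms(6)[OF that] ch q by (simp add: modified_riemann_extension_def Let_def)
    have "(?gc has_real_derivative (S t - scalar_curvature ?A (g t) q) * ?gc t) (at t within I)"
      using assms(7) t ch q
      by (simp add: yamabe_flow_def has_time_derivative_def cotangent_bundle_def tensor_comp_def)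
    \<comment> \<open>The component is known to be 1 only at times in \<open>I\<close>, hence the
      comparison with a constant function within \<open>I\<close>; the radius 1 is
      arbitrary.\<close>
    moreover have "(?gc has_real_derivative 0) (at t within I)"
      by (rule has_field_derivative_transform_within[OF DERIV_const[of 1] zero_less_one t]) (simp add: one)
    ultimately have "(S t - scalar_curvature ?A (g t) q) * ?gc t = 0"
      using has_field_derivative_unique nontrivial[OF t] by blast
    then show ?thesis
      using one[OF t] by simp
  qed
  show ?thesis
    unfolding has_time_derivative_def
  proof (intro ballI allI)
    fix t C q i j
    assume t: "t \<in> I" and C: "C \<in> ?A" and q: "q \<in> fst C"
    \<comment> \<open>Every chart in the atlas of the cotangent bundle is induced by a chart of
      \<open>M\<close>, so \<open>curvature\<close> applies at each of its points.\<close>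
    have "scalar_curvature ?A (g t) q = S t"
      using curvature[OF t] C q unfolding cotangent_bundle_def by blast
    \<comment> \<open>The flow equation is now read in an arbitrary component, where the factor in
      front has just been shown to vanish.\<close>
    moreover have "((\<lambda>s. tensor_comp ?A (g s) C q i j) has_real_derivative
        (S t - scalar_curvature ?A (g t) q) * tensor_comp ?A (g t) C q i j) (at t within I)"
      using assms(7) t C q by (simp add: yamabe_flow_def has_time_derivative_def tensor_comp_def)
    ultimately show "((\<lambda>s. tensor_comp ?A (g s) C q i j) has_real_derivative
        tensor_comp ?A (\<lambda>q v w. 0) C q i j) (at t within I)"
      by (simp add: tensor_comp_def)
  qed
qed

end
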